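(* Let $q$ be a prime power, let $t \geq 2$, and let $f(x) = c_1 x^{a_1} + \cdots + c_t x^{a_t} \in \mathbb{F}_q[x]$, where the coefficients $c_i \in \mathbb{F}_q$ are all nonzero and the exponents $a_i$ are nonnegative integers. Let $\delta = \gcd(a_1, a_2, \ldots, a_t, q-1)$, let $C$ denote the size of the largest coset in $\mathbb{F}_q^*$ on which $f$ vanishes completely, and let $R(f)$ denote the number of distinct, nonzero roots of $f$ in $\mathbb{F}_q^*$. Then $$ R(f) \leq 2 (q-1)^{1-1/(t-1)} C^{1/(t-1)}, $$ and furthermore, if $C < \delta^{1-1/(t-1)} (q-1)^{1/(t-1)}$, then $$ R(f) \leq 2 (q-1)^{1-1/(t-1)} \delta^{1/(t-1)}. $$
   Context: $\mathbb{F}_q$ is the finite field with $q$ elements and $\mathbb{F}_q^*$ is its (cyclic) multiplicative group. A coset in $\mathbb{F}_q^*$ means a coset $\alpha H$ of a subgroup $H$ of $\mathbb{F}_q^*$, with $\alpha \in \mathbb{F}_q^*$; its size is $|H|$ (so single elements of $\mathbb{F}_q^*$ are cosets of size $1$). $f$ vanishes completely on a coset if every element of the coset is a root of $f$. If $f$ has no roots in $\mathbb{F}_q^*$, then $C = 0$ by convention (and $0^{1/(t-1)} = 0$).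
   Formalization: The second bound is proved only when some exponent a_i is 0 (f not divisible by x); as printed it fails: for x^4 - x over F_7, δ = 1, C = R = 3 < 6, but the bound gives 2. The first bound has no added hypothesis. *)

theory Defs
  imports
    Complex_Main
    "HOL-Library.Cardinality"
    "HOL-Algebra.Coset"
    "HOL-Computational_Algebra.Polynomial"
begin

text \<open>
  The finite field with \<open>q\<close> elements is a type \<open>'a\<close> of class \<open>field\<close> and \<open>finite\<close> with
  \<open>q = CARD('a)\<close>; that \<open>q\<close> is a prime power is then automatic.
\<close>

definition mult_grp :: "'a::field monoid" where
  "mult_grp = \<lparr>carrier = UNIV - {0}, monoid.mult = (*), one = 1\<rparr>"

definition is_coset :: "'a::field set \<Rightarrow> bool" where
  "is_coset S \<longleftrightarrow>
    (\<exists>H \<alpha>. subgroup H mult_grp \<and> \<alpha> \<in> carrier mult_grp \<and> S = \<alpha> <#\<^bsub>mult_grp\<^esub> H)"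

definition nonzero_roots :: "'a::field poly \<Rightarrow> 'a set" where
  "nonzero_roots f = {x. x \<noteq> 0 \<and> poly f x = 0}"

definition num_roots :: "'a::field poly \<Rightarrow> nat" where
  "num_roots f = card (nonzero_roots f)"

text \<open>
  Every nonzero root is a coset of size 1, so the maximum below is over a nonempty set exactly
  when \<open>f\<close> has a nonzero root; otherwise the value is 0 by convention.
\<close>

definition max_coset :: "'a::{field,finite} poly \<Rightarrow> nat" where
  "max_coset f =
    (if nonzero_roots f = {} then 0
     else Max {card S | S. is_coset S \<and> (\<forall>x\<in>S. poly f x = 0)})"

text \<open>
  Dividing \<open>f\<close> by a power of \<open>x\<close> does not change its nonzero roots, but it does change this gcd.
  It is the right parameter only when \<open>f\<close> is normalized so that 0 is one of the exponents: for
  \<open>x^4 - x\<close> over the field with 7 elements it is 1, while the nonzero roots form a coset of size 3.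
\<close>

definition exp_gcd :: "nat \<Rightarrow> nat \<Rightarrow> (nat \<Rightarrow> nat) \<Rightarrow> nat" where
  "exp_gcd q t a = gcd (Gcd (a ` {1..t})) (q - 1)"

end

(*
  Let w be a primitive root and N = q - 1. For y in F_q^* and a fixed e, the values f (y w^(e v)),
  v = 0, 1, ..., depend on the exponents only through e a_i mod N. If e is chosen so that all of
  these are congruent to numbers r_i with |r_i| <= B, then f (y w^(e v)) is, up to a factor w^(-B v),
  a polynomial of degree at most 2 B in w^v. Either this polynomial is zero for some y, and then f
  vanishes on a coset of size N / gcd e N, or counting the pairs (y, v) with f (y w^(e v)) = 0 in
  two ways gives R(f) <= 2 B.

  Blichfeldt's argument (more than N^s points in the translates of a box by the multiples of
  (a_2, ..., a_t) mod N, where s = t - 1 and a_1 = 0) yields e < m with B <= N / m^(1/s). For the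
  first bound take m about N / C: then e < N / C, so the vanishing coset would be larger than C.
  For the second bound everything is divided by \<delta>: with n = N / \<delta> and m = n one gets
  B <= n^(1 - 1/s), and gcd e n <= B because gcd e n divides some nonzero r_i. A vanishing coset has
  size at least N / B >= \<delta>^(1 - 1/s) N^(1/s), which the hypothesis on C excludes.
*)

theory Submission
  imports "HOL-Algebra.Multiplicative_Group" "HOL-Number_Theory.Cong" Defs
begin

section \<open>Primitive roots, and counting roots along geometric progressions\<close>

lemma card_field_minus_1_pos: "CARD('a::{field,finite}) - 1 > 0"
  using card_mono[of "UNIV :: 'a set" "{0, 1}"] by simp

lemma power_eq_of_cong:
  fixes w :: "'a::monoid_mult"
  assumes "w ^ N = 1" "[i = j] (mod N)"
  shows "w ^ i = w ^ j"
proof -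
  have "w ^ k = w ^ (k mod N)" for k
  proof -
    have "w ^ k = w ^ (N * (k div N) + k mod N)"
      by simp
    also have "\<dots> = w ^ (k mod N)"
      unfolding power_add power_mult by (simp add: \<open>w ^ N = 1\<close>)
    finally show ?thesis .
  qed
  with assms(2) show ?thesis
    by (metis cong_def)
qed

lemma finite_field_primitive_root:
  obtains w :: "'a::{field,finite}" where "w \<noteq> 0" "w ^ (CARD('a) - 1) = 1"
    "inj_on (\<lambda>i. w ^ i) {..<CARD('a) - 1}"
proof -
  \<comment> \<open>The field is repackaged as a record with explicit carrier, so that the theorem
    that its multiplicative group is cyclic can be quoted.\<close>
  define K :: "'a ring" where
    "K = \<lparr>carrier = UNIV, monoid.mult = (*), one = 1, ring.zero = 0, add = (+)\<rparr>"
  have carr: "carrier K = UNIV" and zero: "\<zero>\<^bsub>K\<^esub> = 0" and one: "\<one>\<^bsub>K\<^esub> = 1"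
    by (simp_all add: K_def)
  have "\<exists>y. x + y = 0" for x :: 'a
    by (rule exI[of _ "- x"]) simp
  moreover have "\<exists>y. x * y = 1" if "x \<noteq> 0" for x :: 'a
    using that by (intro exI[of _ "inverse x"]) simp
  ultimately interpret K: Ring.field K
    by unfold_locales (auto simp: K_def algebra_simps Units_def)
  have pow: "x [^]\<^bsub>K\<^esub> i = x ^ i" for x :: 'a and i :: nat
    by (induction i) (simp_all add: K_def mult.commute)
  define N where "N = CARD('a) - 1"
  have card: "card (UNIV - {0 :: 'a}) = N"
    by (simp add: N_def)
  obtain w :: 'a where w: "w \<noteq> 0" and gen: "UNIV - {0} = {w ^ i | i :: nat. True}"
    using K.finite_field_mult_group_has_gen by (auto simp: carr zero pow)
  have "w ^ N = 1"
  proof -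
    interpret M: group "mult_of K"
      by (rule K.field_mult_group)
    have "w [^]\<^bsub>mult_of K\<^esub> Coset.order (mult_of K) = \<one>\<^bsub>mult_of K\<^esub>"
      using w by (intro M.pow_order_eq_1) (simp add: carr zero)
    then show ?thesis
      by (simp add: nat_pow_mult_of pow one Coset.order_def carr zero N_def)
  qed
  have "N > 0"
    unfolding N_def by (rule card_field_minus_1_pos)
  have "UNIV - {0} = (\<lambda>i. w ^ i) ` {..<N}"
  proof -
    have "w ^ i = w ^ (i mod N)" for i
      by (rule power_eq_of_cong[OF \<open>w ^ N = 1\<close>]) (simp add: cong_def)
    then show ?thesis
      using \<open>N > 0\<close> by (auto simp: gen intro!: rev_image_eqI[where x = "_ mod N"])
  qed
  then have "card ((\<lambda>i. w ^ i) ` {..<N}) = card {..<N}"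
    using card by simp
  then have "inj_on (\<lambda>i. w ^ i) {..<N}"
    by (intro eq_card_imp_inj_on) simp_all
  with w \<open>w ^ N = 1\<close> show ?thesis
    by (intro that) (simp_all add: N_def)
qed

text \<open>Since \<delta> divides all exponents, only e a_i / \<delta> modulo n matters, and
  \<open>r i\<close> is a small representative of it. The variable of the auxiliary polynomial is
  then w^(\<delta> v), which takes n distinct values; this is where the factor \<delta> in the bound
  comes from.\<close>

lemma sparse_roots_le_or_vanishing_progression:
  fixes w :: "'a::{field,finite}" and c :: "'i \<Rightarrow> 'a" and a :: "'i \<Rightarrow> nat" and r :: "'i \<Rightarrow> int"
    and I :: "'i set" and e n \<delta> B :: nat
  defines "F \<equiv> \<lambda>x. \<Sum>i\<in>I. c i * x ^ a i"
  assumes I: "finite I" and N: "n * \<delta> = CARD('a) - 1" and e: "e > 0"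
    and w0: "w \<noteq> 0" and w1: "w ^ (n * \<delta>) = 1" and inj: "inj_on (\<lambda>i. w ^ i) {..<n * \<delta>}"
    and dvd: "\<And>i. i \<in> I \<Longrightarrow> \<delta> dvd a i"
    and r: "\<And>i. i \<in> I \<Longrightarrow> [int (e * a i) = int \<delta> * r i] (mod int (n * \<delta>))"
    and rB: "\<And>i. i \<in> I \<Longrightarrow> \<bar>r i\<bar> \<le> int B"
  shows "card {x. x \<noteq> 0 \<and> F x = 0} \<le> 2 * B * \<delta> \<or>
    (\<exists>y. y \<noteq> 0 \<and> (\<forall>v. F (y * w ^ (gcd e n * v)) = 0))"
proof -
  have npos: "n > 0" "\<delta> > 0"
    using card_field_minus_1_pos[where 'a = 'a] unfolding N[symmetric] by simp_all
  \<comment> \<open>Adding \<open>B\<close> moves the \<open>r i\<close> into the range from 0 to 2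
    B. Distinct i may share one \<open>r i\<close>, so monomials may cancel and \<open>P y\<close>
    may be zero.\<close>
  define P where "P y = (\<Sum>i\<in>I. Polynomial.monom (c i * y ^ a i) (nat (r i + int B)))" for y
  have degP: "degree (P y) \<le> 2 * B" for y
    unfolding P_def
  proof (rule degree_sum_le[OF I])
    fix i assume "i \<in> I"
    have "degree (Polynomial.monom (c i * y ^ a i) (nat (r i + int B))) \<le> nat (r i + int B)"
      by (rule degree_monom_le)
    also have "\<dots> \<le> 2 * B"
      using rB[OF \<open>i \<in> I\<close>] by linarith
    finally show "degree (Polynomial.monom (c i * y ^ a i) (nat (r i + int B))) \<le> 2 * B" .
  qed
  have evalP: "poly (P y) (w ^ (\<delta> * v)) = w ^ (\<delta> * v * B) * F (y * w ^ (e * v))" for y v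
  proof -
    have "(w ^ (\<delta> * v)) ^ nat (r i + int B) = w ^ (\<delta> * v * B) * (w ^ (e * v)) ^ a i" if "i \<in> I" for i
    proof -
      have "[int v * (int \<delta> * r i) = int v * int (e * a i)] (mod int (n * \<delta>))"
        by (intro cong_mult cong_refl cong_sym[OF r[OF that]])
      then have "[int v * (int \<delta> * r i) + int (\<delta> * v * B) = int v * int (e * a i) + int (\<delta> * v * B)]
          (mod int (n * \<delta>))"
        by (rule cong_add) (rule cong_refl)
      moreover have "int (\<delta> * v * nat (r i + int B)) = int v * (int \<delta> * r i) + int (\<delta> * v * B)"
        using rB[OF that] by (simp add: algebra_simps)
      moreover have "int (\<delta> * v * B + e * v * a i) = int v * int (e * a i) + int (\<delta> * v * B)"
        by (simp add: algebra_simps)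
      ultimately have "[\<delta> * v * nat (r i + int B) = \<delta> * v * B + e * v * a i] (mod (n * \<delta>))"
        by (metis cong_int_iff)
      from power_eq_of_cong[OF w1 this] show ?thesis
        by (simp only: power_add power_mult)
    qed
    then show ?thesis
      by (auto simp: P_def F_def poly_sum poly_monom sum_distrib_left power_mult_distrib mult_ac intro!: sum.cong)
  qed
  show ?thesis
  proof (cases "\<exists>y. y \<noteq> 0 \<and> P y = 0")
    case True
    then obtain y where y: "y \<noteq> 0" "P y = 0"
      by blast
    have zero: "F (y * w ^ (e * v)) = 0" for v
      using evalP[of y v] y w0 by simp
    \<comment> \<open>Bezout passes from multiples of e to multiples of gcd e n: the extra factor
      w^(n q v) is invisible to F, because \<delta> divides every \<open>a i\<close> and w^(n
      \<delta>) = 1.\<close>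
    obtain p q where pq: "e * p = n * q + gcd e n"
      using bezout_nat[of e n] e by auto
    have "F (y * w ^ (gcd e n * v)) = 0" for v
    proof -
      have "(w ^ (n * q * v)) ^ a i = 1" if i: "i \<in> I" for i
      proof -
        obtain b where "a i = \<delta> * b"
          using dvd[OF i] by blast
        then have "(w ^ (n * q * v)) ^ a i = (w ^ (n * \<delta>)) ^ (q * v * b)"
          by (simp flip: power_mult add: mult_ac)
        then show ?thesis
          by (simp add: w1)
      qed
      moreover have "w ^ (e * (p * v)) = w ^ (gcd e n * v) * w ^ (n * q * v)"
      proof -
        have "e * (p * v) = (n * q + gcd e n) * v"
          unfolding pq[symmetric] by (rule mult.assoc[symmetric])
        also have "\<dots> = gcd e n * v + n * q * v"
          by (simp only: distrib_right add.commute)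
        finally have "e * (p * v) = gcd e n * v + n * q * v" .
        then show ?thesis
          by (simp only: power_add)
      qed
      ultimately have "F (y * w ^ (e * (p * v))) = F (y * w ^ (gcd e n * v))"
        unfolding F_def by (intro sum.cong) (simp_all add: power_mult_distrib)
      then show ?thesis
        using zero by simp
    qed
    then show ?thesis
      using y by blast
  next
    case False
    define G where "G = UNIV - {0 :: 'a}"
    have "finite G" "card G = n * \<delta>"
      by (simp_all add: G_def N)
    have few: "card {v \<in> {..<n}. F (y * w ^ (e * v)) = 0} \<le> 2 * B" if "y \<in> G" for y
    proof -
      have "P y \<noteq> 0"
        using False that by (auto simp: G_def)
      have "card {v \<in> {..<n}. F (y * w ^ (e * v)) = 0} \<le> card {x. poly (P y) x = 0}"
      proof (rule card_inj_on_le[where f = "\<lambda>v. w ^ (\<delta> * v)"])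
        show "inj_on (\<lambda>v. w ^ (\<delta> * v)) {v \<in> {..<n}. F (y * w ^ (e * v)) = 0}"
        proof (rule inj_onI)
          fix u v
          assume *: "u \<in> {v \<in> {..<n}. F (y * w ^ (e * v)) = 0}"
            "v \<in> {v \<in> {..<n}. F (y * w ^ (e * v)) = 0}" "w ^ (\<delta> * u) = w ^ (\<delta> * v)"
          then have "\<delta> * u = \<delta> * v"
            using inj_onD[OF inj *(3)] npos by (simp add: mult.commute)
          then show "u = v"
            using npos by simp
        qed
      qed (auto simp: evalP)
      also have "\<dots> \<le> degree (P y)"
        using \<open>P y \<noteq> 0\<close> by (rule card_poly_roots_bound)
      also have "\<dots> \<le> 2 * B"
        by (rule degP)
      finally show ?thesis .
    qed
    have shift: "card {y \<in> G. F (y * w ^ (e * v)) = 0} = card {x. x \<noteq> 0 \<and> F x = 0}" for v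
      by (rule bij_betw_same_card[of "\<lambda>y. y * w ^ (e * v)"],
          rule bij_betw_byWitness[where f' = "\<lambda>y. y / w ^ (e * v)"])
        (auto simp: G_def w0)
    \<comment> \<open>For each of the n values of v, the map y -> y w^(e v) permutes the nonzero
      elements and hits every root once. Each of the n \<delta> values of y accounts for at most 2 B
      pairs, and n cancels.\<close>
    have "n * card {x. x \<noteq> 0 \<and> F x = 0} = (\<Sum>v\<in>{..<n}. card {x. x \<noteq> 0 \<and> F x = 0})"
      by simp
    also have "\<dots> = (\<Sum>y\<in>G. card {v \<in> {..<n}. F (y * w ^ (e * v)) = 0})"
      by (rule sum_multicount_gen[symmetric]) (simp_all add: \<open>finite G\<close> shift)
    also have "\<dots> \<le> (\<Sum>y\<in>G. 2 * B)"
      by (rule sum_mono) (rule few)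
    also have "\<dots> = n * (2 * B * \<delta>)"
      using \<open>card G = n * \<delta>\<close> by simp
    finally show ?thesis
      using npos by simp
  qed
qed

section \<open>The multiplicative group and its cosets\<close>

lemma group_mult_grp: "group (mult_grp :: 'a::field monoid)"
proof (rule groupI)
  fix x :: 'a assume "x \<in> carrier mult_grp"
  then show "\<exists>y\<in>carrier mult_grp. y \<otimes>\<^bsub>mult_grp\<^esub> x = \<one>\<^bsub>mult_grp\<^esub>"
    by (intro bexI[of _ "inverse x"]) (simp_all add: mult_grp_def)
qed (auto simp: mult_grp_def)

lemma zero_notin_coset: "is_coset S \<Longrightarrow> 0 \<notin> S"
  by (auto simp: is_coset_def l_coset_def mult_grp_def dest!: subgroup.subset)

lemma is_coset_singleton:
  fixes x :: "'a::field"
  assumes "x \<noteq> 0"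
  shows "is_coset {x}"
  unfolding is_coset_def using assms
  by (intro exI[of _ "{1}"] exI[of _ x])
    (use group.triv_subgroup[OF group_mult_grp[where 'a = 'a]] in \<open>simp add: mult_grp_def l_coset_def\<close>)

lemma is_coset_powers:
  fixes w y :: "'a::{field,finite}"
  assumes N: "d * m = CARD('a) - 1" and w0: "w \<noteq> 0" and w1: "w ^ (d * m) = 1"
    and inj: "inj_on (\<lambda>i. w ^ i) {..<d * m}" and y: "y \<noteq> 0"
  shows "is_coset (range (\<lambda>v. y * w ^ (d * v)))" "card (range (\<lambda>v. y * w ^ (d * v))) \<ge> m"
proof -
  define H where "H = range (\<lambda>v. w ^ (d * v))"
  have "d * m > 0"
    unfolding N by (rule card_field_minus_1_pos)
  note grp = group_mult_grp[where 'a = 'a]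
  have "subgroup H mult_grp"
  proof (rule group.subgroupI[OF grp])
    show "H \<subseteq> carrier mult_grp"
      by (auto simp: H_def mult_grp_def w0)
    show "H \<noteq> {}"
      by (simp add: H_def)
    fix g h assume "g \<in> H" "h \<in> H"
    then show "g \<otimes>\<^bsub>mult_grp\<^esub> h \<in> H"
      by (auto simp: H_def mult_grp_def simp flip: power_add distrib_left)
    obtain v where v: "g = w ^ (d * v)"
      using \<open>g \<in> H\<close> by (auto simp: H_def)
    \<comment> \<open>As w^(d m) = 1, the exponent v (m - 1) stands in for -v among the natural
      numbers.\<close>
    have "w ^ (d * (v * (m - 1))) * g = (w ^ (d * m)) ^ v"
      using \<open>d * m > 0\<close> unfolding v power_add[symmetric] power_mult[symmetric]
      by (cases m) (simp_all add: algebra_simps)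
    then have "w ^ (d * (v * (m - 1))) \<otimes>\<^bsub>mult_grp\<^esub> g = \<one>\<^bsub>mult_grp\<^esub>"
      by (simp add: w1 mult_grp_def)
    then have "inv\<^bsub>mult_grp\<^esub> g = w ^ (d * (v * (m - 1)))"
      by (rule group.inv_equality[OF grp]) (simp_all add: v mult_grp_def w0)
    then show "inv\<^bsub>mult_grp\<^esub> g \<in> H"
      by (auto simp: H_def)
  qed
  then show "is_coset (range (\<lambda>v. y * w ^ (d * v)))"
    unfolding is_coset_def using y
    by (intro exI[of _ H] exI[of _ y]) (auto simp: mult_grp_def l_coset_def H_def)
  have "inj_on (\<lambda>v. y * w ^ (d * v)) {..<m}"
  proof (rule inj_onI)
    fix u v assume *: "u \<in> {..<m}" "v \<in> {..<m}" "y * w ^ (d * u) = y * w ^ (d * v)"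
    then have "w ^ (d * u) = w ^ (d * v)"
      using y by simp
    with * \<open>d * m > 0\<close> have "d * u = d * v"
      by (intro inj_onD[OF inj]) simp_all
    then show "u = v"
      using \<open>d * m > 0\<close> by simp
  qed
  then have "m = card ((\<lambda>v. y * w ^ (d * v)) ` {..<m})"
    by (simp add: card_image)
  also have "\<dots> \<le> card (range (\<lambda>v. y * w ^ (d * v)))"
    by (rule card_mono) auto
  finally show "card (range (\<lambda>v. y * w ^ (d * v))) \<ge> m" .
qed

lemma card_le_max_coset:
  fixes f :: "'a::{field,finite} poly"
  assumes "is_coset S" and "\<And>x. x \<in> S \<Longrightarrow> poly f x = 0"
  shows "card S \<le> max_coset f"
proof -
  obtain H \<alpha> where H: "subgroup H mult_grp" "\<alpha> \<noteq> 0" "S = (\<lambda>h. \<alpha> * h) ` H"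
    using assms(1) by (auto simp: is_coset_def mult_grp_def l_coset_def)
  \<comment> \<open>The coset contains \<alpha>, a nonzero root of f, so \<open>max_coset f\<close>
    is a genuine maximum and not the conventional value 0.\<close>
  have "1 \<in> H"
    using subgroup.one_closed[OF H(1)] by (simp add: mult_grp_def)
  then have "\<alpha> \<in> S"
    using H by force
  then have "nonzero_roots f \<noteq> {}"
    using H assms(2) by (auto simp: nonzero_roots_def)
  then show ?thesis
    unfolding max_coset_def using assms by (auto intro!: Max_ge)
qed

section \<open>Simultaneous small multiples by the pigeonhole principle\<close>

lemma simultaneous_small_multiples:
  fixes b :: "'i \<Rightarrow> nat" and n m k :: nat
  assumes J: "finite J" and k: "0 < k" "k \<le> n" and large: "n ^ card J < m * k ^ card J"
  obtains e r where "0 < e" "e < m"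
    "\<And>i. i \<in> J \<Longrightarrow> [int (e * b i) = r i] (mod int n) \<and> \<bar>r i\<bar> < int k"
proof -
  \<comment> \<open>A pair (e, z) is the point z of a box of side k, translated by e times the
    vector b and reduced modulo n. By \<open>large\<close> there are more such points than residue
    vectors, so two of them collide.\<close>
  define A where "A = {..<m} \<times> (J \<rightarrow>\<^sub>E {..<k})"
  define h where "h = (\<lambda>(e, z). \<lambda>i\<in>J. (e * b i + z i) mod n)"
  have "n > 0"
    using k by simp
  have "finite A" "card A = m * k ^ card J"
    using J by (auto simp: A_def card_cartesian_product card_PiE intro!: finite_PiE)
  moreover have "h ` A \<subseteq> (J \<rightarrow>\<^sub>E {..<n})"
    using \<open>n > 0\<close> by (auto simp: h_def)
  then have "card (h ` A) \<le> n ^ card J"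
    using J card_mono[OF finite_PiE[OF J], of "\<lambda>_. {..<n}" "h ` A"] by (simp add: card_PiE)
  ultimately have "\<not> inj_on h A"
    using large by (intro pigeonhole) simp
  then obtain e z e' z' where A: "(e, z) \<in> A" "(e', z') \<in> A" and ne: "(e, z) \<noteq> (e', z')"
    and eq: "h (e, z) = h (e', z')" and le: "e' \<le> e"
    unfolding inj_on_def by (metis nat_le_linear surj_pair)
  have cong: "[e * b i + z i = e' * b i + z' i] (mod n)" if "i \<in> J" for i
    using fun_cong[OF eq, of i] that by (simp add: h_def cong_def)
  have lt: "z i < k" "z' i < k" if "i \<in> J" for i
    using A that by (auto simp: A_def PiE_iff)
  \<comment> \<open>Within a single translate, points are distinct modulo n because k <= n. So the
    collision joins two translates, and the difference of their multipliers is the multiplier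
    sought: it sends b to a difference of two box points, whose entries are below k in absolute
    value.\<close>
  have "e \<noteq> e'"
  proof
    assume "e = e'"
    have "z = z'"
    proof (rule PiE_ext)
      show "z \<in> J \<rightarrow>\<^sub>E {..<k}" "z' \<in> J \<rightarrow>\<^sub>E {..<k}"
        using A by (auto simp: A_def)
      fix i assume "i \<in> J"
      have "[z i = z' i] (mod n)"
        using cong[OF \<open>i \<in> J\<close>] \<open>e = e'\<close> by (simp add: cong_add_lcancel_nat)
      then show "z i = z' i"
        using lt[OF \<open>i \<in> J\<close>] k by (auto simp: cong_def)
    qed
    with ne \<open>e = e'\<close> show False
      by simp
  qed
  show thesis
  proof (rule that[of "e - e'" "\<lambda>i. int (z' i) - int (z i)"])
    show "0 < e - e'" "e - e' < m"
      using \<open>e \<noteq> e'\<close> le A by (auto simp: A_def)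
    fix i assume i: "i \<in> J"
    have "[int (e * b i + z i) = int (e' * b i + z' i)] (mod int n)"
      using cong[OF i] by (simp only: cong_int_iff)
    then have "[int (e * b i + z i) - int (e' * b i + z i) = int (e' * b i + z' i) - int (e' * b i + z i)] (mod int n)"
      by (intro cong_diff cong_refl)
    moreover have "int (e * b i + z i) - int (e' * b i + z i) = int ((e - e') * b i)"
      using le by (simp add: algebra_simps)
    ultimately show "[int ((e - e') * b i) = int (z' i) - int (z i)] (mod int n) \<and>
        \<bar>int (z' i) - int (z i)\<bar> < int k"
      using lt[OF i] by auto
  qed
qed

text \<open>With x = n / m^(1/s) one has m x^s = n^s, so any integer side above x satisfies the
  strict inequality; k is the least one. The assumption m >= 2 gives x < n and hence k <= n. The
  bound is on k - 1 because the residues produced by a box of side k are at most k - 1 in absolute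
  value.\<close>

lemma box_side_exists:
  fixes n m s :: nat
  assumes "n > 0" "m \<ge> 2" "s \<ge> 1"
  obtains k where "0 < k" "k \<le> n" "n ^ s < m * k ^ s" "real (k - 1) \<le> real n / real m powr (1 / real s)"
proof -
  define x where "x = real n / real m powr (1 / real s)"
  define k where "k = nat \<lfloor>x\<rfloor> + 1"
  have m1: "real m powr (1 / real s) > 1"
    using assms by (intro gr_one_powr) auto
  have x: "0 \<le> x" "x < real n"
    using assms m1 by (simp_all add: x_def divide_less_eq)
  have "x < real k"
    using x by (simp add: k_def) linarith
  have "real (n ^ s) = x ^ s * real m"
  proof -
    have "(real m powr (1 / real s)) ^ s = real m"
      using assms by (simp add: powr_powr flip: powr_realpow)
    then show ?thesis
      using assms by (simp add: x_def power_divide)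
  qed
  also have "\<dots> < real k ^ s * real m"
    using \<open>x < real k\<close> x assms by (intro mult_strict_right_mono power_strict_mono) auto
  finally have "n ^ s < m * k ^ s"
    by (metis mult.commute of_nat_less_iff of_nat_mult of_nat_power)
  moreover have "real (k - 1) \<le> x" "k \<le> n"
    using x by (simp_all add: k_def) linarith+
  ultimately show thesis
    using that[of k] by (simp add: k_def x_def)
qed

text \<open>The exponent \<open>a i0\<close> is 0 modulo q - 1 and stays so under every multiplier,
  so the box needs only \<open>card I - 1\<close> dimensions; hence the roots of order t - 1 in the
  final bounds. The small residues of e a_i remain in the conclusion because the second bound uses
  them to estimate gcd e n.\<close>

lemma sparse_roots_le_or_vanishing_coset:
  fixes c :: "'i \<Rightarrow> 'a::{field,finite}" and a :: "'i \<Rightarrow> nat" and I :: "'i set"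
    and n \<delta> m k :: nat
  defines "F \<equiv> \<lambda>x. \<Sum>i\<in>I. c i * x ^ a i"
  assumes I: "finite I" "i0 \<in> I" and N: "n * \<delta> = CARD('a) - 1"
    and a0: "n * \<delta> dvd a i0" and dvd: "\<And>i. i \<in> I \<Longrightarrow> \<delta> dvd a i"
    and k: "0 < k" "k \<le> n" and large: "n ^ (card I - 1) < m * k ^ (card I - 1)"
  shows "\<exists>e>0. e < m \<and>
    (\<forall>i\<in>I. \<exists>r. [int (e * a i) = int \<delta> * r] (mod int (n * \<delta>)) \<and> \<bar>r\<bar> < int k) \<and>
    (card {x. x \<noteq> 0 \<and> F x = 0} \<le> 2 * (k - 1) * \<delta> \<or>
      (\<exists>S. is_coset S \<and> (\<forall>x\<in>S. F x = 0) \<and> n * \<delta> \<le> gcd e n * card S))"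
proof -
  obtain w :: 'a where w: "w \<noteq> 0" "w ^ (n * \<delta>) = 1" "inj_on (\<lambda>i. w ^ i) {..<n * \<delta>}"
    using finite_field_primitive_root unfolding N by blast
  have card: "card (I - {i0}) = card I - 1"
    using I by simp
  obtain e r where e: "0 < e" "e < m"
    and r: "\<And>i. i \<in> I - {i0} \<Longrightarrow> [int (e * (a i div \<delta>)) = r i] (mod int n) \<and> \<bar>r i\<bar> < int k"
    using simultaneous_small_multiples[of "I - {i0}" k n m "\<lambda>i. a i div \<delta>"] I k large
    unfolding card by auto
  define r' where "r' = r(i0 := 0)"
  have r': "[int (e * a i) = int \<delta> * r' i] (mod int (n * \<delta>)) \<and> \<bar>r' i\<bar> < int k" if i: "i \<in> I" for i
  proof (cases "i = i0")
    case True
    have "n * \<delta> dvd e * a i0"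
      using a0 by simp
    then have "[int (e * a i0) = 0] (mod int (n * \<delta>))"
      unfolding cong_0_iff by (simp only: int_dvd_int_iff)
    then show ?thesis
      using True k by (simp add: r'_def)
  next
    case False
    have "[int \<delta> * int (e * (a i div \<delta>)) = int \<delta> * r i] (mod int \<delta> * int n)"
      using r[of i] i False by (auto intro: cong_cmult_leftI)
    moreover have "int \<delta> * int (e * (a i div \<delta>)) = int (e * a i)"
      using dvd[OF i] by (metis dvd_mult_div_cancel mult.left_commute of_nat_mult)
    ultimately have "[int (e * a i) = int \<delta> * r i] (mod int (n * \<delta>))"
      by (simp only: of_nat_mult mult.commute[of "int n"])
    then show ?thesis
      using r[of i] i False by (simp add: r'_def)
  qed
  have "card {x. x \<noteq> 0 \<and> F x = 0} \<le> 2 * (k - 1) * \<delta> \<or>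
    (\<exists>y. y \<noteq> 0 \<and> (\<forall>v. F (y * w ^ (gcd e n * v)) = 0))"
    unfolding F_def
    by (rule sparse_roots_le_or_vanishing_progression[OF I(1) N e(1) w dvd, where r = r']) (use r' k in force)+
  moreover have "\<exists>S. is_coset S \<and> (\<forall>x\<in>S. F x = 0) \<and> n * \<delta> \<le> gcd e n * card S"
    if y: "y \<noteq> 0" "\<And>v. F (y * w ^ (gcd e n * v)) = 0" for y
  proof -
    \<comment> \<open>This is the order of w^(gcd e n), since w has order n \<delta>.\<close>
    define l where "l = n div gcd e n * \<delta>"
    have l: "gcd e n * l = n * \<delta>"
      by (simp add: l_def flip: mult.assoc)
    let ?S = "range (\<lambda>v. y * w ^ (gcd e n * v))"
    have "is_coset ?S" "l \<le> card ?S"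
      using is_coset_powers[of "gcd e n" l w y] w y N by (simp_all add: l)
    moreover from this have "gcd e n * l \<le> gcd e n * card ?S"
      by simp
    ultimately show ?thesis
      using y by (intro exI[of _ ?S]) (auto simp: l)
  qed
  ultimately have "card {x. x \<noteq> 0 \<and> F x = 0} \<le> 2 * (k - 1) * \<delta> \<or>
      (\<exists>S. is_coset S \<and> (\<forall>x\<in>S. F x = 0) \<and> n * \<delta> \<le> gcd e n * card S)"
    by metis
  moreover have "\<forall>i\<in>I. \<exists>r. [int (e * a i) = int \<delta> * r] (mod int (n * \<delta>)) \<and> \<bar>r\<bar> < int k"
    using r' by blast
  ultimately show ?thesis
    using e by (intro exI[of _ e] conjI)
qed

section \<open>The two bounds on the number of roots\<close>

lemma num_roots_le_max_coset:
  fixes f :: "'a::{field,finite} poly" and c :: "'i \<Rightarrow> 'a" and a :: "'i \<Rightarrow> nat" and I :: "'i set"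
  assumes f: "\<And>x. poly f x = (\<Sum>i\<in>I. c i * x ^ a i)" and I: "finite I" "card I = s + 1" "s \<ge> 1"
    and N: "N = CARD('a) - 1"
  shows "real (num_roots f) \<le> 2 * real N powr (1 - 1 / real s) * real (max_coset f) powr (1 / real s)"
proof (cases "nonzero_roots f = {}")
  case True
  then show ?thesis
    by (simp add: num_roots_def)
next
  case False
  define C where "C = max_coset f"
  obtain x where "x \<noteq> 0" "poly f x = 0"
    using False by (auto simp: nonzero_roots_def)
  then have "C > 0"
    using card_le_max_coset[OF is_coset_singleton, of x f] by (simp add: C_def)
  have "num_roots f \<le> card (UNIV - {0 :: 'a})"
    unfolding num_roots_def nonzero_roots_def by (rule card_mono) auto
  then have RN: "num_roots f \<le> N"
    by (simp add: N)
  have "N > 0"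
    unfolding N by (rule card_field_minus_1_pos)
  \<comment> \<open>For C >= N the trivial estimate R <= N suffices. For C < N the quotient N / C
    exceeds 1, which makes m >= 2 below.\<close>
  show ?thesis
  proof (cases "C < N")
    case False
    have "real (num_roots f) \<le> real N powr (1 - 1 / real s) * real N powr (1 / real s)"
      using RN \<open>N > 0\<close> by (simp flip: powr_add)
    also have "\<dots> \<le> real N powr (1 - 1 / real s) * real C powr (1 / real s)"
      using False by (intro mult_left_mono powr_mono2) auto
    also have "\<dots> \<le> 2 * real N powr (1 - 1 / real s) * real C powr (1 / real s)"
      by simp
    finally show ?thesis
      by (simp add: C_def)
  next
    case True
    \<comment> \<open>Rounding up serves both sides: an integer e < m is still below N / C, so a
      vanishing coset of size at least N / e would exceed C, while m >= N / C gives N / m^(1/s) <=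
      N^(1 - 1/s) C^(1/s).\<close>
    define m where "m = nat \<lceil>real N / real C\<rceil>"
    have quot: "real N / real C > 1"
      using True \<open>C > 0\<close> by simp
    have m: "m \<ge> 2" "real m \<ge> real N / real C" "real m < real N / real C + 1"
      using quot unfolding m_def by linarith+
    then have "m > 0"
      by simp
    obtain k where k: "0 < k" "k \<le> N" "N ^ s < m * k ^ s" "real (k - 1) \<le> real N / real m powr (1 / real s)"
      using box_side_exists[OF \<open>N > 0\<close> \<open>m \<ge> 2\<close> I(3)] by blast
    obtain i0 where i0: "i0 \<in> I"
      using I by force
    \<comment> \<open>Represents \<open>a i - a i0\<close> modulo \<open>N\<close> by a natural number.\<close>
    define a' where "a' i = a i + (N - 1) * a i0" for i
    have f': "(\<Sum>i\<in>I. c i * x ^ a' i) = poly f x * x ^ ((N - 1) * a i0)" for x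
      by (simp add: f a'_def power_add sum_distrib_right mult.assoc)
    have "a' i0 = N * a i0"
      using \<open>N > 0\<close> by (cases N) (simp_all add: a'_def)
    then have "\<And>i. i \<in> I \<Longrightarrow> 1 dvd a' i" "N * 1 dvd a' i0" "N * 1 = CARD('a) - 1"
      "N ^ (card I - 1) < m * k ^ (card I - 1)"
      using k I by (simp_all add: N)
    from sparse_roots_le_or_vanishing_coset
      [where n = N and \<delta> = 1 and a = a' and c = c, OF I(1) i0 this(3,2,1) k(1,2) this(4)]
    obtain e where e: "0 < e" "e < m"
      and alt: "card {x. x \<noteq> 0 \<and> (\<Sum>i\<in>I. c i * x ^ a' i) = 0} \<le> 2 * (k - 1) \<or>
        (\<exists>S. is_coset S \<and> (\<forall>x\<in>S. (\<Sum>i\<in>I. c i * x ^ a' i) = 0) \<and> N \<le> gcd e N * card S)"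
      unfolding mult_1_right by blast
    have False if S: "is_coset S" "\<forall>x\<in>S. (\<Sum>i\<in>I. c i * x ^ a' i) = 0" "N \<le> gcd e N * card S" for S
    proof -
      \<comment> \<open>The shifted sum is f times a power of x, and a coset avoids 0.\<close>
      have "poly f x = 0" if "x \<in> S" for x
      proof -
        have "x \<noteq> 0"
          using zero_notin_coset[OF S(1)] that by auto
        moreover have "poly f x * x ^ ((N - 1) * a i0) = 0"
          using S(2) that unfolding f' by blast
        ultimately show ?thesis
          by simp
      qed
      then have "card S \<le> C"
        using card_le_max_coset S(1) unfolding C_def by blast
      moreover have "gcd e N \<le> e"
        using e by simp
      ultimately have "gcd e N * card S \<le> e * C"
        by (intro mult_le_mono) auto
      with S(3) have "real N \<le> real e * real C"
        by (simp flip: of_nat_mult)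
      then have "real N / real C \<le> real e"
        using \<open>C > 0\<close> by (simp add: divide_le_eq)
      then show False
        using m e by linarith
    qed
    moreover have "{x. x \<noteq> 0 \<and> (\<Sum>i\<in>I. c i * x ^ a' i) = 0} = nonzero_roots f"
      unfolding nonzero_roots_def f' by auto
    ultimately have "num_roots f \<le> 2 * (k - 1)"
      using alt unfolding num_roots_def by auto
    then have "real (num_roots f) \<le> 2 * real (k - 1)"
      by (metis of_nat_le_iff of_nat_mult of_nat_numeral)
    also have "\<dots> \<le> 2 * (real N / real m powr (1 / real s))"
      using k by simp
    also have "\<dots> \<le> 2 * (real N / (real N / real C) powr (1 / real s))"
    proof (intro mult_left_mono divide_left_mono powr_mono2)
      show "0 < real m powr (1 / real s) * (real N / real C) powr (1 / real s)"
        using \<open>m > 0\<close> \<open>N > 0\<close> \<open>C > 0\<close> by simp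
    qed (use m(2) in simp_all)
    also have "\<dots> = 2 * real N powr (1 - 1 / real s) * real C powr (1 / real s)"
      using \<open>N > 0\<close> \<open>C > 0\<close> by (simp add: powr_divide powr_diff)
    finally show ?thesis
      by (simp add: C_def)
  qed
qed

text \<open>The exponents are not shifted here, since that could change \<delta>; the exponent 0 at
  \<open>i0\<close> takes the place of the shift. The multiplier may range up to n = N / \<delta>,
  because gcd e n is controlled through a nonzero residue instead of through e <= m.\<close>

lemma num_roots_le_exponent_gcd:
  fixes f :: "'a::{field,finite} poly" and c :: "'i \<Rightarrow> 'a" and a :: "'i \<Rightarrow> nat" and I :: "'i set"
  assumes f: "\<And>x. poly f x = (\<Sum>i\<in>I. c i * x ^ a i)" and I: "finite I" "card I = s + 1" "s \<ge> 1"
    and N: "N = CARD('a) - 1" and i0: "i0 \<in> I" "a i0 = 0" and \<delta>: "\<delta> = gcd (Gcd (a ` I)) N"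
    and C: "real (max_coset f) < real \<delta> powr (1 - 1 / real s) * real N powr (1 / real s)"
  shows "real (num_roots f) \<le> 2 * real N powr (1 - 1 / real s) * real \<delta> powr (1 / real s)"
proof -
  have "num_roots f \<le> card (UNIV - {0 :: 'a})"
    unfolding num_roots_def nonzero_roots_def by (rule card_mono) auto
  then have RN: "num_roots f \<le> N"
    by (simp add: N)
  have "N > 0"
    unfolding N by (rule card_field_minus_1_pos)
  have "\<delta> dvd N"
    by (simp add: \<delta>)
  then obtain n where n: "N = n * \<delta>"
    by (metis dvd_def mult.commute)
  then have pos: "n > 0" "\<delta> > 0"
    using \<open>N > 0\<close> by simp_all
  have dvd: "\<delta> dvd a i" if "i \<in> I" for i
    using that unfolding \<delta> by (meson Gcd_dvd dvd_trans gcd_dvd1 image_eqI)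
  show ?thesis
  \<comment> \<open>For n = 1 one has \<delta> = N and the claimed bound is 2 N; otherwise n >= 2,
    so that m = n is admissible for the box.\<close>
  proof (cases "n = 1")
    case True
    then have "real N powr (1 - 1 / real s) * real \<delta> powr (1 / real s) = real N"
      using n \<open>N > 0\<close> by (simp flip: powr_add)
    then show ?thesis
      using RN by (simp add: mult.assoc)
  next
    case False
    then have "n \<ge> 2"
      using pos by simp
    obtain k where k: "0 < k" "k \<le> n" "n ^ s < n * k ^ s" "real (k - 1) \<le> real n / real n powr (1 / real s)"
      using box_side_exists[OF pos(1) \<open>n \<ge> 2\<close> I(3)] by blast
    have "n * \<delta> = CARD('a) - 1" "n * \<delta> dvd a i0" "n ^ (card I - 1) < n * k ^ (card I - 1)"
      using k I i0 by (simp_all add: N flip: n)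
    from sparse_roots_le_or_vanishing_coset
      [where \<delta> = \<delta> and a = a and c = c, OF I(1) i0(1) this(1,2) dvd k(1,2) this(3)]
    obtain e where e: "0 < e" "e < n"
      and res: "\<And>i. i \<in> I \<Longrightarrow> \<exists>r. [int (e * a i) = int \<delta> * r] (mod int (n * \<delta>)) \<and> \<bar>r\<bar> < int k"
      and alt: "card {x. x \<noteq> 0 \<and> (\<Sum>i\<in>I. c i * x ^ a i) = 0} \<le> 2 * (k - 1) * \<delta> \<or>
        (\<exists>S. is_coset S \<and> (\<forall>x\<in>S. (\<Sum>i\<in>I. c i * x ^ a i) = 0) \<and> n * \<delta> \<le> gcd e n * card S)"
      by blast
    have gcd_le: "gcd e n \<le> k - 1"
    proof -
      \<comment> \<open>Otherwise N would divide e times the gcd of all \<open>a i\<close> and N,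
        that is e \<delta>. Then n would divide e, against 0 < e < n.\<close>
      have "\<exists>i\<in>I. \<not> N dvd e * a i"
      proof (rule ccontr)
        assume "\<not> (\<exists>i\<in>I. \<not> N dvd e * a i)"
        then have "N dvd Gcd ((*) e ` (a ` I))"
          by (auto intro!: Gcd_greatest)
        then have "N dvd e * Gcd (a ` I)"
          by (simp add: Gcd_mult)
        then have "N dvd gcd (e * Gcd (a ` I)) (e * N)"
          by simp
        also have "\<dots> = e * \<delta>"
          by (simp add: \<delta> gcd_mult_distrib_nat)
        finally have "n dvd e"
          using pos by (simp add: n)
        then show False
          using e dvd_imp_le[of n e] by simp
      qed
      then obtain i where i: "i \<in> I" "\<not> N dvd e * a i"
        by blast
      obtain r where r: "[int (e * a i) = int \<delta> * r] (mod int (n * \<delta>))" "\<bar>r\<bar> < int k"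
        using res[OF i(1)] by blast
      have "r \<noteq> 0"
      proof
        assume "r = 0"
        then have "[int (e * a i) = 0] (mod int N)"
          using r(1) by (simp add: n)
        with i(2) show False
          unfolding cong_0_iff by (simp only: int_dvd_int_iff)
      qed
      \<comment> \<open>With a_i = \<delta> b, cancelling \<delta> gives r congruent to e b modulo
        n, and gcd e n divides both e and n.\<close>
      moreover have "int (gcd e n) dvd r"
      proof -
        obtain b where b: "a i = \<delta> * b"
          using dvd[OF i(1)] by blast
        have "int \<delta> * int n dvd int \<delta> * (int e * int b - r)"
          using r(1) unfolding cong_iff_dvd_diff b of_nat_mult
          by (simp only: right_diff_distrib mult_ac)
        then have "int n dvd int e * int b - r"
          using pos by simp
        then have "int (gcd e n) dvd int e * int b - r"
          by (rule dvd_trans[rotated]) simp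
        then have "int (gcd e n) dvd int e * int b - (int e * int b - r)"
          by (rule dvd_diff[rotated]) simp
        then show ?thesis
          by simp
      qed
      ultimately have "int (gcd e n) \<le> \<bar>r\<bar>"
        using dvd_imp_le_int[of r "int (gcd e n)"] by simp
      then show ?thesis
        using r(2) by linarith
    qed
    have False if S: "is_coset S" "\<forall>x\<in>S. (\<Sum>i\<in>I. c i * x ^ a i) = 0" "n * \<delta> \<le> gcd e n * card S" for S
    proof -
      have "card S \<le> max_coset f"
        using S by (intro card_le_max_coset) (auto simp: f)
      with S(3) gcd_le have "n * \<delta> \<le> (k - 1) * max_coset f"
        by (meson mult_le_mono order_trans)
      then have "real n * real \<delta> \<le> real (k - 1) * real (max_coset f)"
        by (metis of_nat_le_iff of_nat_mult)
      also have "\<dots> \<le> real n / real n powr (1 / real s) * real (max_coset f)"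
        using k by (intro mult_right_mono) auto
      finally have "real n powr (1 / real s) * real \<delta> \<le> real (max_coset f)"
        using pos by (simp add: field_simps)
      \<comment> \<open>A vanishing coset has size at least N / (k - 1) >= n^(1/s) \<delta>; in
        terms of N this is exactly the threshold in the hypothesis on C.\<close>
      moreover have "real n powr (1 / real s) * real \<delta> = real \<delta> powr (1 - 1 / real s) * real N powr (1 / real s)"
        using pos by (simp add: n powr_mult powr_diff)
      ultimately show False
        using C by simp
    qed
    then have "num_roots f \<le> 2 * (k - 1) * \<delta>"
      using alt unfolding num_roots_def nonzero_roots_def f by blast
    then have "real (num_roots f) \<le> 2 * real (k - 1) * real \<delta>"
      by (metis of_nat_le_iff of_nat_mult of_nat_numeral)
    also have "\<dots> \<le> 2 * (real n / real n powr (1 / real s)) * real \<delta>"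
      using k by (intro mult_right_mono mult_left_mono) auto
    also have "\<dots> = 2 * real N powr (1 - 1 / real s) * real \<delta> powr (1 / real s)"
      using pos by (simp add: n powr_mult powr_diff)
    finally show ?thesis .
  qed
qed


text \<open>The second bound is restricted to polynomials with an exponent 0 because it can fail
  otherwise: x^4 - x over the field with 7 elements has t = 2, \<delta> = 1 and C = 3 < 6, so the
  bound would be 2, but there are 3 nonzero roots.\<close>

theorem theorem2p3:
  fixes c :: "nat \<Rightarrow> 'a::{field,finite}" and a :: "nat \<Rightarrow> nat"
    and f :: "'a poly" and t q \<delta> C R :: nat
  assumes "q = CARD('a)"
    and "t \<ge> 2"
    and "\<forall>i\<in>{1..t}. c i \<noteq> 0"
    and "f = (\<Sum>i=1..t. monom (c i) (a i))"
    and "\<delta> = exp_gcd q t a"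
    and "C = max_coset f"
    and "R = num_roots f"
  shows "real R \<le> 2 * (real q - 1) powr (1 - 1 / (real t - 1)) * real C powr (1 / (real t - 1))
    \<and> ((\<exists>i\<in>{1..t}. a i = 0) \<and>
       real C < real \<delta> powr (1 - 1 / (real t - 1)) * (real q - 1) powr (1 / (real t - 1))
       \<longrightarrow> real R \<le> 2 * (real q - 1) powr (1 - 1 / (real t - 1)) * real \<delta> powr (1 / (real t - 1)))"
proof -
  have f: "poly f x = (\<Sum>i\<in>{1..t}. c i * x ^ a i)" for x
    by (simp add: assms(4) poly_sum poly_monom)
  have q: "real q - 1 = real (q - 1)"
    using zero_less_card_finite[where 'a = 'a] by (simp add: assms(1))
  have t: "real t - 1 = real (t - 1)"
    using assms(2) by simp
  have card: "finite {1..t}" "card {1..t} = t - 1 + 1" "t - 1 \<ge> 1"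
    using assms(2) by simp_all
  have N: "q - 1 = CARD('a) - 1"
    by (simp add: assms(1))
  have \<delta>: "\<delta> = gcd (Gcd (a ` {1..t})) (q - 1)"
    by (simp add: assms(5) exp_gcd_def)
  show ?thesis
    unfolding q t assms(6,7)
    using num_roots_le_max_coset[OF f card N] num_roots_le_exponent_gcd[OF f card N _ _ \<delta>] by blast
qed

end
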